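(* Let $H\in\mathbb{R}^{n\times n}$ satisfy $\rho(H)<1$ and have no zero row and no zero column, and let $H^{+}\in\mathbb{R}^{n\times n}$ be the nonnegative matrix with entries $H^{+}_{i,j}=|H_{i,j}|$. Then the following are equivalent: (i) there exist an integer $m\ge 1$ and an $m$-way transition hypermatrix $P=(P^{(1)},\dots,P^{(m)})$ admissible for $H$ such that $\|\tilde H\|_\infty<1$; (ii) $\rho(H^{+})<1$.
   Context: $\rho(\cdot)$ denotes the spectral radius and $\|A\|_\infty=\max_i\sum_j|A_{i,j}|$. An $m$-way transition hypermatrix is a tuple $P=(P^{(1)},\dots,P^{(m)})$ of $n\times n$ row-stochastic matrices (nonnegative entries, each row summing to $1$), with entries $P^{(\ell)}_{i,j}$. It is admissible for $H$ if $H_{i,j}\neq 0$ implies $P^{(\ell)}_{i,j}\neq 0$ for all $i,j$ and all $\ell=1,\dots,m$. For such $P$ define, for $\ell=1,\dots,m$, the matrix $\hat H^{(\ell)}$ by $\hat H^{(\ell)}_{i,j}=H_{i,j}^2/P^{(\ell)}_{i,j}$ if $H_{i,j}\neq 0$ and $\hat H^{(\ell)}_{i,j}=0$ if $H_{i,j}=0$, and set $\tilde H=\hat H^{(1)}\hat H^{(2)}\cdots\hat H^{(m)}$. *)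

theory Defs
  imports "Jordan_Normal_Form.Spectral_Radius"
begin

text \<open>The spectrum of a real matrix is taken over the complex numbers. The maximum in
  \<^const>\<open>spectral_radius\<close> is meaningful for matrices of positive dimension.\<close>

definition real_spectral_radius :: "real mat \<Rightarrow> real" where
  "real_spectral_radius A = spectral_radius (map_mat complex_of_real A)"

text \<open>As above, the dimension has to be positive for the maximum to be meaningful.\<close>

definition inf_norm_mat :: "real mat \<Rightarrow> real" where
  "inf_norm_mat A = Max ((\<lambda>i. \<Sum>j<dim_col A. \<bar>A $$ (i, j)\<bar>) ` {..<dim_row A})"

definition row_stochastic :: "nat \<Rightarrow> real mat \<Rightarrow> bool" where
  "row_stochastic n P \<longleftrightarrow> P \<in> carrier_mat n n \<and>
     (\<forall>i<n. \<forall>j<n. 0 \<le> P $$ (i, j)) \<and> (\<forall>i<n. (\<Sum>j<n. P $$ (i, j)) = 1)"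

text \<open>A tuple \<open>(P\<^sup>1, \<dots>, P\<^sup>m)\<close> is a list of length \<open>m\<close>.\<close>

definition transition_hypermatrix :: "nat \<Rightarrow> nat \<Rightarrow> real mat list \<Rightarrow> bool" where
  "transition_hypermatrix n m Ps \<longleftrightarrow> length Ps = m \<and> (\<forall>P \<in> set Ps. row_stochastic n P)"

definition admissible :: "real mat \<Rightarrow> real mat list \<Rightarrow> bool" where
  "admissible H Ps \<longleftrightarrow> (\<forall>P \<in> set Ps. \<forall>i<dim_row H. \<forall>j<dim_col H.
     H $$ (i, j) \<noteq> 0 \<longrightarrow> P $$ (i, j) \<noteq> 0)"

definition hat_mat :: "real mat \<Rightarrow> real mat \<Rightarrow> real mat" where
  "hat_mat H P = mat (dim_row H) (dim_col H)
     (\<lambda>(i, j). if H $$ (i, j) \<noteq> 0 then (H $$ (i, j))\<^sup>2 / P $$ (i, j) else 0)"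

definition tilde_mat :: "real mat \<Rightarrow> real mat list \<Rightarrow> real mat" where
  "tilde_mat H Ps = foldr (\<lambda>P M. hat_mat H P * M) Ps (1\<^sub>m (dim_row H))"

definition no_zero_row :: "real mat \<Rightarrow> bool" where
  "no_zero_row H \<longleftrightarrow> (\<forall>i<dim_row H. \<exists>j<dim_col H. H $$ (i, j) \<noteq> 0)"

definition no_zero_col :: "real mat \<Rightarrow> bool" where
  "no_zero_col H \<longleftrightarrow> (\<forall>j<dim_col H. \<exists>i<dim_row H. H $$ (i, j) \<noteq> 0)"

end

theory Submission
  imports Defs "HOL-Analysis.Convex"
begin

text \<open>
  Write \<open>A = |H|\<close> for the entrywise absolute value and let all inequalities and squares of
  vectors be entrywise. Everything rests on how \<open>\<hat>H\<close> acts on \<^emph>\<open>squares\<close> of vectors.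

  For every admissible \<open>P\<close> and every vector \<open>y\<close>, the Cauchy--Schwarz inequality with the weights of
  a row of \<open>P\<close>, which sum to one, gives \<open>(A y)\<^sup>2 \<le> \<hat>H (y\<^sup>2)\<close>
  (\<open>square_mat_act_abs_le_mat_act_hat\<close>). Iterating over the factors of the product \<open>\<tilde>H\<close> yields
  \<open>(A\<^sup>m 1)\<^sup>2 \<le> \<tilde>H 1\<close>, so a product of norm below one forces all row sums of \<open>A\<^sup>m\<close> below one. Bounding
  an eigenvector of \<open>A\<close> by its largest entry, no eigenvalue can then have modulus \<open>\<ge> 1\<close>
  (\<open>spectral_radius_less_1_if_power_row_sums_less_1\<close>).

  Conversely, equality in Cauchy--Schwarz is attained for a prescribed \<open>y = v > 0\<close> by choosing
  \<open>P\<^sub>i\<^sub>j = A\<^sub>i\<^sub>j v\<^sub>j / (A v)\<^sub>i\<close>, that is, \<open>\<hat>H (v\<^sup>2) = (A v)\<^sup>2\<close> (\<open>mat_act_hat_tilted\<close>). When \<open>A\<close> has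
  spectral radius below one, a truncated Neumann series produces a vector \<open>v \<ge> 1\<close> with
  \<open>A v \<le> r v\<close> for some \<open>r < 1\<close> (\<open>contracted_positive_vector\<close>). With \<open>m\<close> copies of this \<open>P\<close>,
  \<open>\<tilde>H 1 \<le> \<tilde>H (v\<^sup>2) \<le> r\<^sup>2\<^sup>m v\<^sup>2\<close>, which is below one for large \<open>m\<close>.
\<close>

section \<open>Matrices acting on functions\<close>

text \<open>Vectors are represented by functions on the natural numbers of which only the values below
  the dimension matter; powers of a matrix then become iterates of a function.\<close>

definition mat_act :: "'a::semiring_1 mat \<Rightarrow> (nat \<Rightarrow> 'a) \<Rightarrow> nat \<Rightarrow> 'a" where
  "mat_act A x i = (\<Sum>j<dim_col A. A $$ (i, j) * x j)"

lemma mat_act_cong: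
  assumes "\<And>j. j < dim_col A \<Longrightarrow> x j = y j"
  shows "mat_act A x i = mat_act A y i"
  using assms by (simp add: mat_act_def)

lemma mat_act_mult:
  assumes "A \<in> carrier_mat n k" "B \<in> carrier_mat k l" "i < n"
  shows "mat_act (A * B) x i = mat_act A (mat_act B x) i"
proof -
  have "mat_act (A * B) x i = (\<Sum>j<l. \<Sum>h<k. A $$ (i, h) * B $$ (h, j) * x j)"
    unfolding mat_act_def using assms
    by (intro sum.cong) (auto simp: scalar_prod_def sum_distrib_right lessThan_atLeast0)
  also have "\<dots> = (\<Sum>h<k. \<Sum>j<l. A $$ (i, h) * B $$ (h, j) * x j)"
    by (rule sum.swap)
  also have "\<dots> = mat_act A (mat_act B x) i"
    unfolding mat_act_def using assms by (simp add: sum_distrib_left mult.assoc)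
  finally show ?thesis .
qed

lemma mat_act_one_mat: "i < n \<Longrightarrow> mat_act (1\<^sub>m n) x i = x i"
  by (simp add: mat_act_def if_distrib[where f = "\<lambda>c. c * _"] cong: if_cong)

lemma mat_act_pow:
  assumes "A \<in> carrier_mat n n" "i < n"
  shows "mat_act (A ^\<^sub>m k) x i = (mat_act A ^^ k) x i"
proof (induction k arbitrary: x)
  case 0
  then show ?case using assms by (auto simp: mat_act_one_mat)
next
  case (Suc k)
  have "mat_act (A ^\<^sub>m Suc k) x i = mat_act (A ^\<^sub>m k) (mat_act A x) i"
    using mat_act_mult[OF pow_carrier_mat[OF assms(1)] assms(1) assms(2)] by simp
  with Suc show ?case by (simp add: funpow_swap1)
qed

lemma mat_act_mono:
  fixes x y :: "nat \<Rightarrow> real"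
  assumes "A \<in> carrier_mat n n" "\<And>i j. i < n \<Longrightarrow> j < n \<Longrightarrow> 0 \<le> A $$ (i, j)"
    and "\<And>j. j < n \<Longrightarrow> x j \<le> y j" "i < n"
  shows "mat_act A x i \<le> mat_act A y i"
  using assms by (auto simp: mat_act_def intro!: sum_mono mult_left_mono)

lemma mat_act_nonneg:
  fixes x :: "nat \<Rightarrow> real"
  assumes "A \<in> carrier_mat n n" "\<And>i j. i < n \<Longrightarrow> j < n \<Longrightarrow> 0 \<le> A $$ (i, j)"
    and "\<And>j. j < n \<Longrightarrow> 0 \<le> x j" "i < n"
  shows "0 \<le> mat_act A x i"
  using assms by (auto simp: mat_act_def intro!: sum_nonneg)

lemma mat_act_scale: "mat_act A (\<lambda>j. c * x j) i = c * mat_act A x i"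
  for c :: "'a::comm_semiring_1"
  by (simp add: mat_act_def sum_distrib_left mult.left_commute)

lemma mat_act_sum: "mat_act A (\<lambda>j. \<Sum>k\<in>K. x k j) i = (\<Sum>k\<in>K. mat_act A (x k) i)"
  unfolding mat_act_def by (simp add: sum_distrib_left sum.swap[of _ K])

text \<open>For nonnegative matrices the supremum norm is attained at the all-ones vector.\<close>

lemma inf_norm_less_iff_mat_act:
  assumes "A \<in> carrier_mat n n" "n \<ge> 1" "\<And>i j. i < n \<Longrightarrow> j < n \<Longrightarrow> 0 \<le> A $$ (i, j)"
  shows "inf_norm_mat A < c \<longleftrightarrow> (\<forall>i<n. mat_act A (\<lambda>_. 1) i < c)"
proof -
  have "0 \<in> {..<n}" using assms(2) by simp
  then have "{..<n} \<noteq> {}" by blast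
  then show ?thesis
    using assms(1,3) by (simp add: inf_norm_mat_def mat_act_def Ball_def[of "{..<n}"])
qed

section \<open>Spectral radius below one\<close>

text \<open>A subinvariance argument: if \<open>A w = \<lambda> w\<close>, then \<open>|\<lambda>|\<^sup>m |w| \<le> A\<^sup>m |w|\<close>, and evaluating at the
  largest entry of \<open>|w|\<close> compares \<open>|\<lambda>|\<^sup>m\<close> with a row sum of \<open>A\<^sup>m\<close>.\<close>

lemma spectral_radius_less_1_if_power_row_sums_less_1:
  assumes A: "A \<in> carrier_mat n n" and n: "n \<ge> 1"
    and nonneg: "\<And>i j. i < n \<Longrightarrow> j < n \<Longrightarrow> 0 \<le> A $$ (i, j)"
    and less: "\<And>i. i < n \<Longrightarrow> (mat_act A ^^ m) (\<lambda>_. 1) i < 1"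
  shows "real_spectral_radius A < 1"
proof -
  let ?C = "map_mat complex_of_real A"
  have C: "?C \<in> carrier_mat n n" using A by simp
  obtain ev where ev: "ev \<in> spectrum ?C" and rad: "spectral_radius ?C = norm ev"
    using spectral_radius_mem_max(1)[OF C] n by auto
  then obtain w where "eigenvector ?C w ev"
    by (auto simp: spectrum_def eigenvalue_def)
  then have w: "w \<in> carrier_vec n" "w \<noteq> 0\<^sub>v n" and eq: "?C *\<^sub>v w = ev \<cdot>\<^sub>v w"
    using A by (auto simp: eigenvector_def)
  have step: "norm ev * norm (w $ i) \<le> mat_act A (\<lambda>j. norm (w $ j)) i" if i: "i < n" for i
  proof -
    have "ev * w $ i = (?C *\<^sub>v w) $ i" using eq w i by simp
    also have "\<dots> = (\<Sum>j<n. of_real (A $$ (i, j)) * w $ j)"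
      using A w i by (simp add: scalar_prod_def lessThan_atLeast0)
    finally have "norm ev * norm (w $ i) = norm (\<Sum>j<n. of_real (A $$ (i, j)) * w $ j)"
      by (metis norm_mult)
    also have "\<dots> \<le> (\<Sum>j<n. norm (of_real (A $$ (i, j)) * w $ j))" by (rule norm_sum)
    also have "\<dots> = mat_act A (\<lambda>j. norm (w $ j)) i"
      using A nonneg i by (simp add: mat_act_def norm_mult)
    finally show ?thesis .
  qed
  have iter: "norm ev ^ k * norm (w $ i) \<le> (mat_act A ^^ k) (\<lambda>j. norm (w $ j)) i"
    if "i < n" for k i
    using that
  proof (induction k arbitrary: i)
    case (Suc k)
    have "norm ev ^ Suc k * norm (w $ i) \<le> norm ev ^ k * mat_act A (\<lambda>j. norm (w $ j)) i"
      using mult_left_mono[OF step[OF Suc.prems], of "norm ev ^ k"] by (simp add: mult_ac)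
    also have "\<dots> = mat_act A (\<lambda>j. norm ev ^ k * norm (w $ j)) i"
      by (rule mat_act_scale[symmetric])
    also have "\<dots> \<le> mat_act A ((mat_act A ^^ k) (\<lambda>j. norm (w $ j))) i"
      by (rule mat_act_mono[OF A nonneg Suc.IH Suc.prems])
    finally show ?case by simp
  qed simp
  define W where "W = Max ((\<lambda>i. norm (w $ i)) ` {..<n})"
  have "W \<in> (\<lambda>i. norm (w $ i)) ` {..<n}"
    unfolding W_def using n by (intro Max_in) (auto simp: lessThan_empty_iff bot_nat_def)
  then obtain i where i: "i < n" and Wi: "W = norm (w $ i)" by auto
  have le_W: "norm (w $ j) \<le> W" if "j < n" for j
    unfolding W_def using that by (intro Max_ge) auto
  obtain j where "j < n" "w $ j \<noteq> 0"
    using w by (metis carrier_vecD eq_vecI index_zero_vec(1) index_zero_vec(2))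
  then have W: "W > 0" using le_W[of j] by (smt (verit) zero_less_norm_iff)
  have bound: "(mat_act A ^^ k) (\<lambda>j. norm (w $ j)) l \<le> W * (mat_act A ^^ k) (\<lambda>_. 1) l"
    if "l < n" for k l
    using that
  proof (induction k arbitrary: l)
    case (Suc k)
    from mat_act_mono[OF A nonneg Suc.IH Suc.prems] show ?case
      by (simp add: mat_act_scale)
  qed (simp add: le_W)
  have "norm ev ^ m * W \<le> W * (mat_act A ^^ m) (\<lambda>_. 1) i"
    using iter[OF i, of m] bound[OF i, of m] Wi by simp
  also have "\<dots> < W * 1" using W less[OF i] by (intro mult_strict_left_mono) auto
  finally have "norm ev ^ m < 1" using W by simp
  then have "norm ev < 1" by (metis not_le one_le_power)
  with rad show ?thesis by (simp add: real_spectral_radius_def)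
qed

lemma eigenvalue_smult_mat:
  fixes A :: "'a::field mat"
  assumes "A \<in> carrier_mat n n" "c \<noteq> 0" "eigenvalue (c \<cdot>\<^sub>m A) ev"
  shows "eigenvalue A (ev / c)"
proof -
  from assms(3) obtain w where "eigenvector (c \<cdot>\<^sub>m A) w ev"
    by (auto simp: eigenvalue_def)
  then have w: "w \<in> carrier_vec n" "w \<noteq> 0\<^sub>v n" and eq: "(c \<cdot>\<^sub>m A) *\<^sub>v w = ev \<cdot>\<^sub>v w"
    using assms(1) by (auto simp: eigenvector_def)
  have "A *\<^sub>v w = (ev / c) \<cdot>\<^sub>v w"
  proof (rule eq_vecI)
    fix i assume "i < dim_vec ((ev / c) \<cdot>\<^sub>v w)"
    then have i: "i < n" using w by simp
    have "c * (A *\<^sub>v w) $ i = ((c \<cdot>\<^sub>m A) *\<^sub>v w) $ i"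
      using assms(1) w i by (simp add: scalar_prod_def sum_distrib_left mult.assoc)
    also have "\<dots> = ev * w $ i" using eq w i by simp
    finally show "(A *\<^sub>v w) $ i = ((ev / c) \<cdot>\<^sub>v w) $ i"
      using w i assms(2) by (simp add: field_simps)
  qed (use assms(1) w in auto)
  then show ?thesis
    using assms(1) w unfolding eigenvalue_def eigenvector_def by auto
qed

text \<open>The spectral radius of \<open>A\<close> stays below one after dividing \<open>A\<close> by some \<open>t < 1\<close>; boundedness of
  the powers of \<open>A / t\<close> is geometric decay of the powers of \<open>A\<close>. It is stated for the action on the
  all-ones vector, which is all that the Neumann series needs.\<close>

lemma iterates_on_ones_tendsto_0:
  assumes A: "A \<in> carrier_mat n n" and n: "n \<ge> 1" and rad: "real_spectral_radius A < 1"
    and i: "i < n"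
  shows "(\<lambda>k. (mat_act A ^^ k) (\<lambda>_. 1) i) \<longlonglongrightarrow> 0"
proof -
  let ?C = "map_mat complex_of_real"
  obtain t where t: "real_spectral_radius A < t" "t < 1" using rad dense by blast
  have CA: "?C A \<in> carrier_mat n n" using A by simp
  have "real_spectral_radius A \<ge> 0"
    using spectral_radius_mem_max(1)[OF CA] n by (auto simp: real_spectral_radius_def)
  with t have t0: "t > 0" by simp
  define B where "B = (1 / t) \<cdot>\<^sub>m A"
  have B: "B \<in> carrier_mat n n" and CB: "?C B \<in> carrier_mat n n"
    using A by (auto simp: B_def)
  have CB_eq: "?C B = complex_of_real (1 / t) \<cdot>\<^sub>m ?C A"
    by (rule eq_matI) (auto simp: B_def)
  have "spectral_radius (?C B) < 1"
  proof -
    obtain ev where ev: "eigenvalue (?C B) ev" and eq: "spectral_radius (?C B) = norm ev"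
      using spectral_radius_mem_max(1)[OF CB] n by (auto simp: spectrum_def)
    have "eigenvalue (?C A) (ev / complex_of_real (1 / t))"
      by (rule eigenvalue_smult_mat[OF CA]) (use t0 ev CB_eq in auto)
    then have "norm (ev / complex_of_real (1 / t)) \<le> spectral_radius (?C A)"
      using n by (intro spectral_radius_mem_max(2)[OF CA]) (auto simp: spectrum_def)
    then have "t * norm ev \<le> real_spectral_radius A"
      using t0 by (simp add: real_spectral_radius_def norm_mult norm_divide mult.commute)
    with t have "t * norm ev < t * 1" by simp
    then have "norm ev < 1" using t0 by (subst (asm) mult_less_cancel_left_pos)
    then show ?thesis using eq by simp
  qed
  from spectral_radius_jnf_norm_bound_less_1_upper_triangular[OF CB this]
  obtain c where c: "\<And>k. norm_bound (?C B ^\<^sub>m k) c" by blast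
  have entry: "\<bar>(B ^\<^sub>m k) $$ (l, j)\<bar> \<le> c" if "l < n" "j < n" for k l j
  proof -
    have "?C B ^\<^sub>m k = ?C (B ^\<^sub>m k)" by (rule of_real_hom.mat_hom_pow[OF B, symmetric])
    with c[of k] have "norm_bound (?C (B ^\<^sub>m k)) c" by simp
    with that carrier_matD[OF pow_carrier_mat[OF B, of k]] show ?thesis
      unfolding norm_bound_def by (simp del: pow_mat_dim)
  qed
  have B_bound: "\<bar>(mat_act B ^^ k) (\<lambda>_. 1) i\<bar> \<le> real n * c" for k
  proof -
    have "\<bar>(mat_act B ^^ k) (\<lambda>_. 1) i\<bar> = \<bar>\<Sum>j<n. (B ^\<^sub>m k) $$ (i, j)\<bar>"
      using mat_act_pow[OF B i, of k "\<lambda>_. 1"] carrier_matD[OF pow_carrier_mat[OF B, of k]]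
      by (simp add: mat_act_def[of "B ^\<^sub>m k"] del: pow_mat_dim)
    also have "\<dots> \<le> (\<Sum>j<n. \<bar>(B ^\<^sub>m k) $$ (i, j)\<bar>)" by (rule sum_abs)
    also have "\<dots> \<le> (\<Sum>j<n. c)" by (rule sum_mono) (use entry i in auto)
    finally show ?thesis by simp
  qed
  have B_act: "mat_act A x l = t * mat_act B x l" if "l < n" for x l
    using A t0 that by (simp add: B_def mat_act_def sum_distrib_left)
  have scale: "(mat_act A ^^ k) (\<lambda>_. 1) l = t ^ k * (mat_act B ^^ k) (\<lambda>_. 1) l" if "l < n" for k l
    using that
  proof (induction k arbitrary: l)
    case (Suc k)
    have "(mat_act A ^^ Suc k) (\<lambda>_. 1) l = t * mat_act B ((mat_act A ^^ k) (\<lambda>_. 1)) l"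
      using B_act Suc.prems by simp
    also have "mat_act B ((mat_act A ^^ k) (\<lambda>_. 1)) l =
        mat_act B (\<lambda>j. t ^ k * (mat_act B ^^ k) (\<lambda>_. 1) j) l"
      by (rule mat_act_cong) (use B Suc.IH in auto)
    finally show ?case by (simp add: mat_act_scale)
  qed simp
  show ?thesis
  proof (rule tendsto_0_le)
    show "(\<lambda>k. t ^ k) \<longlonglongrightarrow> 0"
      using t t0 by (intro LIMSEQ_power_zero) simp
    show "\<forall>\<^sub>F k in sequentially.
        norm ((mat_act A ^^ k) (\<lambda>_. 1) i) \<le> norm (t ^ k) * (real n * c)"
      using B_bound t0 by (auto simp: scale[OF i] abs_mult intro!: always_eventually mult_left_mono)
  qed
qed

text \<open>Take \<open>v = 1 + A 1 + \<dots> + A\<^sup>N\<^sup>-\<^sup>1 1\<close> with \<open>N\<close> so large that \<open>A\<^sup>N 1 \<le> 1/2\<close>. Telescoping gives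
  \<open>A v = v - 1 + A\<^sup>N 1 \<le> v - 1/2\<close>, which is a fixed fraction of \<open>v\<close> because \<open>v\<close> is bounded. For
  irreducible \<open>A\<close> the Perron vector would do; the Neumann series also covers the reducible case.\<close>

lemma contracted_positive_vector:
  assumes A: "A \<in> carrier_mat n n" and n: "n \<ge> 1"
    and nonneg: "\<And>i j. i < n \<Longrightarrow> j < n \<Longrightarrow> 0 \<le> A $$ (i, j)"
    and rad: "real_spectral_radius A < 1"
  obtains v r where "0 \<le> r" "r < 1" "\<And>i. i < n \<Longrightarrow> 1 \<le> v i"
    "\<And>i. i < n \<Longrightarrow> mat_act A v i \<le> r * v i"
proof -
  define x where "x k = (mat_act A ^^ k) (\<lambda>_. 1)" for k
  have x0: "x 0 = (\<lambda>_. 1)" and xS: "x (Suc k) = mat_act A (x k)" for k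
    by (simp_all add: x_def)
  have x_nonneg: "0 \<le> x k i" if "i < n" for k i
    using that
  proof (induction k arbitrary: i)
    case (Suc k)
    then show ?case unfolding xS by (intro mat_act_nonneg[OF A nonneg])
  qed (simp add: x0)
  have "\<forall>\<^sub>F k in sequentially. \<forall>i\<in>{..<n}. x k i < 1 / 2"
    unfolding x_def
    by (intro eventually_ball_finite ballI order_tendstoD(2)[OF iterates_on_ones_tendsto_0[OF A n rad]])
       auto
  then obtain N where N: "\<And>i. i < n \<Longrightarrow> x N i < 1 / 2"
    unfolding eventually_sequentially by blast
  have "N \<noteq> 0"
  proof
    assume "N = 0"
    with N[of 0] n x0 show False by simp
  qed
  define v where "v i = (\<Sum>k<N. x k i)" for i
  have v_ge: "1 \<le> v i" if "i < n" for i
  proof -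
    have "x 0 i \<le> v i"
      unfolding v_def using that \<open>N \<noteq> 0\<close> x_nonneg by (intro member_le_sum) auto
    then show ?thesis by (simp add: x0)
  qed
  have Av: "mat_act A v i \<le> v i - 1 / 2" if "i < n" for i
  proof -
    have "mat_act A v i = (\<Sum>k<N. x (Suc k) i)"
      unfolding v_def xS by (rule mat_act_sum)
    also have "\<dots> = v i - 1 + x N i"
      using sum_lessThan_telescope[of "\<lambda>k. x k i" N] by (simp add: v_def sum_subtractf x0)
    finally show ?thesis using N[OF that] by simp
  qed
  define M where "M = Max (v ` {..<n})"
  have vM: "v i \<le> M" if "i < n" for i
    unfolding M_def using that by (intro Max_ge) auto
  have M: "M \<ge> 1" using v_ge[of 0] vM[of 0] n by auto
  show thesis
  proof (rule that[of "1 - 1 / (2 * M)" v])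
    show "0 \<le> 1 - 1 / (2 * M)" "1 - 1 / (2 * M) < 1" using M by (auto simp: field_simps)
    show "1 \<le> v i" if "i < n" for i by (rule v_ge[OF that])
    show "mat_act A v i \<le> (1 - 1 / (2 * M)) * v i" if "i < n" for i
    proof -
      have "v i / (2 * M) \<le> 1 / 2" using vM[OF that] M by (simp add: field_simps)
      with Av[OF that] show ?thesis by (simp add: algebra_simps)
    qed
  qed
qed

section \<open>Matrices of second moments\<close>

lemma hat_mat_carrier [simp]: "H \<in> carrier_mat n n \<Longrightarrow> hat_mat H P \<in> carrier_mat n n"
  by (simp add: hat_mat_def)

lemma hat_mat_nonneg:
  assumes "H \<in> carrier_mat n n" "row_stochastic n P" "i < n" "j < n"
  shows "0 \<le> hat_mat H P $$ (i, j)"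
  using assms by (auto simp: hat_mat_def row_stochastic_def)

lemma tilde_mat_carrier:
  assumes "H \<in> carrier_mat n n"
  shows "tilde_mat H Ps \<in> carrier_mat n n"
  using assms by (induction Ps) (auto simp: tilde_mat_def intro!: mult_carrier_mat[of _ n n])

lemma tilde_mat_Nil: "tilde_mat H [] = 1\<^sub>m (dim_row H)"
  and tilde_mat_Cons: "tilde_mat H (P # Ps) = hat_mat H P * tilde_mat H Ps"
  by (simp_all add: tilde_mat_def)

lemma tilde_mat_nonneg:
  assumes H: "H \<in> carrier_mat n n" and "\<And>P. P \<in> set Ps \<Longrightarrow> row_stochastic n P" "i < n" "j < n"
  shows "0 \<le> tilde_mat H Ps $$ (i, j)"
  using assms(2-)
proof (induction Ps arbitrary: i j)
  case Nil
  then show ?case using H by (auto simp: tilde_mat_Nil)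
next
  case (Cons P Ps)
  have "tilde_mat H (P # Ps) $$ (i, j) = (\<Sum>k<n. hat_mat H P $$ (i, k) * tilde_mat H Ps $$ (k, j))"
    using Cons.prems carrier_matD[OF hat_mat_carrier[OF H, of P]]
      carrier_matD[OF tilde_mat_carrier[OF H, of Ps]]
    by (simp add: tilde_mat_Cons scalar_prod_def lessThan_atLeast0)
  also have "\<dots> \<ge> 0"
    using Cons.prems
    by (intro sum_nonneg mult_nonneg_nonneg hat_mat_nonneg[OF H] Cons.IH) auto
  finally show ?case .
qed

lemma mat_act_tilde_Cons:
  assumes "H \<in> carrier_mat n n" "i < n"
  shows "mat_act (tilde_mat H (P # Ps)) x i = mat_act (hat_mat H P) (mat_act (tilde_mat H Ps) x) i"
  unfolding tilde_mat_Cons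
  by (rule mat_act_mult[OF hat_mat_carrier[OF assms(1)] tilde_mat_carrier[OF assms(1)] assms(2)])

text \<open>Probabilistically: sample \<open>j\<close> from row \<open>i\<close> of \<open>P\<close>. Then \<open>(A y)\<^sub>i\<close> is the mean of
  \<open>A\<^sub>i\<^sub>j y\<^sub>j / P\<^sub>i\<^sub>j\<close> and \<open>\<hat>H (y\<^sup>2)\<close> its second moment.\<close>

lemma square_mat_act_abs_le_mat_act_hat:
  assumes H: "H \<in> carrier_mat n n" and P: "row_stochastic n P"
    and adm: "\<And>i j. i < n \<Longrightarrow> j < n \<Longrightarrow> H $$ (i, j) \<noteq> 0 \<Longrightarrow> P $$ (i, j) \<noteq> 0" and i: "i < n"
  shows "(mat_act (map_mat abs H) y i)\<^sup>2 \<le> mat_act (hat_mat H P) (\<lambda>j. (y j)\<^sup>2) i"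
proof -
  let ?a = "\<lambda>j. sqrt (P $$ (i, j))"
  let ?b = "\<lambda>j. \<bar>H $$ (i, j)\<bar> * y j / sqrt (P $$ (i, j))"
  have P0: "0 \<le> P $$ (i, j)" if "j < n" for j
    using P i that by (auto simp: row_stochastic_def)
  have "mat_act (map_mat abs H) y i = (\<Sum>j<n. ?a j * ?b j)"
    unfolding mat_act_def using H i adm[OF i] by (force intro!: sum.cong)
  then have "(mat_act (map_mat abs H) y i)\<^sup>2 \<le> (\<Sum>j<n. (?a j)\<^sup>2) * (\<Sum>j<n. (?b j)\<^sup>2)"
    using Cauchy_Schwarz_ineq_sum by metis
  also have "(\<Sum>j<n. (?a j)\<^sup>2) = 1"
    using P P0 i by (simp add: row_stochastic_def)
  also have "(\<Sum>j<n. (?b j)\<^sup>2) = mat_act (hat_mat H P) (\<lambda>j. (y j)\<^sup>2) i"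
    unfolding mat_act_def using H i P0
    by (auto simp: hat_mat_def power_divide power_mult_distrib intro!: sum.cong)
  finally show ?thesis by simp
qed

lemma square_iterates_le_mat_act_tilde:
  assumes H: "H \<in> carrier_mat n n" and "\<And>P. P \<in> set Ps \<Longrightarrow> row_stochastic n P"
    and "admissible H Ps" "i < n"
  shows "((mat_act (map_mat abs H) ^^ length Ps) y i)\<^sup>2 \<le> mat_act (tilde_mat H Ps) (\<lambda>j. (y j)\<^sup>2) i"
  using assms(2-)
proof (induction Ps arbitrary: i)
  case Nil
  then show ?case using H by (simp add: tilde_mat_Nil mat_act_one_mat)
next
  case (Cons P Ps)
  let ?z = "(mat_act (map_mat abs H) ^^ length Ps) y"
  have "(mat_act (map_mat abs H) ?z i)\<^sup>2 \<le> mat_act (hat_mat H P) (\<lambda>j. (?z j)\<^sup>2) i"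
    using Cons.prems H by (intro square_mat_act_abs_le_mat_act_hat) (auto simp: admissible_def)
  also have "\<dots> \<le> mat_act (hat_mat H P) (mat_act (tilde_mat H Ps) (\<lambda>j. (y j)\<^sup>2)) i"
    using Cons.prems H hat_mat_nonneg[OF H]
    by (intro mat_act_mono[where n = n] Cons.IH) (auto simp: admissible_def)
  also have "\<dots> = mat_act (tilde_mat H (P # Ps)) (\<lambda>j. (y j)\<^sup>2) i"
    using mat_act_tilde_Cons[OF H Cons.prems(3)] by simp
  finally show ?case by simp
qed

section \<open>The optimal transition matrix for a positive vector\<close>

definition tilted_transition :: "real mat \<Rightarrow> (nat \<Rightarrow> real) \<Rightarrow> real mat" where
  "tilted_transition A v = mat (dim_row A) (dim_col A) (\<lambda>(i, j). A $$ (i, j) * v j / mat_act A v i)"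

text \<open>The absence of zero rows makes the normalising denominators positive.\<close>

lemma mat_act_abs_pos:
  assumes H: "H \<in> carrier_mat n n" and "no_zero_row H" and v: "\<And>j. j < n \<Longrightarrow> 0 < v j"
    and i: "i < n"
  shows "0 < mat_act (map_mat abs H) v i"
proof -
  obtain j where j: "j < n" "H $$ (i, j) \<noteq> 0"
    using assms by (auto simp: no_zero_row_def)
  have "0 < (\<Sum>j<n. \<bar>H $$ (i, j)\<bar> * v j)"
    by (rule sum_pos2[where i = j]) (use j v in \<open>auto simp: less_imp_le\<close>)
  then show ?thesis using H i by (simp add: mat_act_def)
qed

lemma tilted_transition_row_stochastic:
  assumes H: "H \<in> carrier_mat n n" and nz: "no_zero_row H" and v: "\<And>j. j < n \<Longrightarrow> 0 < v j"
  shows "row_stochastic n (tilted_transition (map_mat abs H) v)"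
proof -
  have "(\<Sum>j<n. \<bar>H $$ (i, j)\<bar> * v j / mat_act (map_mat abs H) v i) = 1" if "i < n" for i
  proof -
    have "mat_act (map_mat abs H) v i > 0" by (rule mat_act_abs_pos[OF H nz v that])
    then show ?thesis using H that by (simp add: mat_act_def flip: sum_divide_distrib)
  qed
  moreover have "0 \<le> mat_act (map_mat abs H) v i" if "i < n" for i
    by (rule less_imp_le[OF mat_act_abs_pos[OF H nz v that]])
  ultimately show ?thesis
    using H v by (auto simp: row_stochastic_def tilted_transition_def less_imp_le
        intro!: divide_nonneg_nonneg)
qed

text \<open>Since \<open>P\<^sub>i\<^sub>j\<close> is proportional to \<open>A\<^sub>i\<^sub>j v\<^sub>j\<close>, the quotients \<open>A\<^sub>i\<^sub>j v\<^sub>j / P\<^sub>i\<^sub>j\<close> are constant on the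
  support of each row: the case of equality in the Cauchy--Schwarz bound.\<close>

lemma mat_act_hat_tilted:
  assumes H: "H \<in> carrier_mat n n" and nz: "no_zero_row H" and v: "\<And>j. j < n \<Longrightarrow> 0 < v j"
    and i: "i < n"
  shows "mat_act (hat_mat H (tilted_transition (map_mat abs H) v)) (\<lambda>j. (v j)\<^sup>2) i
    = (mat_act (map_mat abs H) v i)\<^sup>2"
proof -
  let ?s = "mat_act (map_mat abs H) v i"
  have "hat_mat H (tilted_transition (map_mat abs H) v) $$ (i, j) * (v j)\<^sup>2
      = ?s * (\<bar>H $$ (i, j)\<bar> * v j)" if j: "j < n" for j
  proof (cases "H $$ (i, j) = 0")
    case False
    have "(H $$ (i, j))\<^sup>2 / (\<bar>H $$ (i, j)\<bar> * v j / ?s) * (v j)\<^sup>2 = ?s * (\<bar>H $$ (i, j)\<bar> * v j)"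
      using False v[OF j] mat_act_abs_pos[OF H nz v i]
      by (simp add: field_simps power2_eq_square)
    with False show ?thesis using H i j by (simp add: hat_mat_def tilted_transition_def)
  qed (use H i j in \<open>simp add: hat_mat_def\<close>)
  then have "mat_act (hat_mat H (tilted_transition (map_mat abs H) v)) (\<lambda>j. (v j)\<^sup>2) i
      = ?s * (\<Sum>j<n. \<bar>H $$ (i, j)\<bar> * v j)"
    using carrier_matD[OF hat_mat_carrier[OF H]]
    by (simp add: mat_act_def[of "hat_mat _ _"] sum_distrib_left)
  also have "(\<Sum>j<n. \<bar>H $$ (i, j)\<bar> * v j) = ?s" using H i by (simp add: mat_act_def)
  finally show ?thesis by (simp add: power2_eq_square)
qed

lemma mat_act_tilde_replicate_tilted_le:
  assumes H: "H \<in> carrier_mat n n" and nz: "no_zero_row H" and v: "\<And>j. j < n \<Longrightarrow> 0 < v j"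
    and contr: "\<And>i. i < n \<Longrightarrow> mat_act (map_mat abs H) v i \<le> r * v i" and i: "i < n"
  shows "mat_act (tilde_mat H (replicate m (tilted_transition (map_mat abs H) v))) (\<lambda>j. (v j)\<^sup>2) i
    \<le> (r\<^sup>2) ^ m * (v i)\<^sup>2"
  using i
proof (induction m arbitrary: i)
  case 0
  then show ?case using H by (simp add: tilde_mat_Nil mat_act_one_mat)
next
  case (Suc m)
  let ?P = "tilted_transition (map_mat abs H) v"
  let ?T = "tilde_mat H (replicate m ?P)"
  have "mat_act (tilde_mat H (replicate (Suc m) ?P)) (\<lambda>j. (v j)\<^sup>2) i
      = mat_act (hat_mat H ?P) (mat_act ?T (\<lambda>j. (v j)\<^sup>2)) i"
    using mat_act_tilde_Cons[OF H Suc.prems] by simp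
  also have "\<dots> \<le> mat_act (hat_mat H ?P) (\<lambda>j. (r\<^sup>2) ^ m * (v j)\<^sup>2) i"
    by (intro mat_act_mono[where n = n] hat_mat_carrier H Suc
          hat_mat_nonneg[OF H tilted_transition_row_stochastic[OF H nz v]])
  also have "\<dots> = (r\<^sup>2) ^ m * (mat_act (map_mat abs H) v i)\<^sup>2"
    using mat_act_hat_tilted[OF H nz v Suc.prems] by (simp add: mat_act_scale)
  also have "\<dots> \<le> (r\<^sup>2) ^ m * (r * v i)\<^sup>2"
    by (intro mult_left_mono power_mono contr[OF Suc.prems]
          less_imp_le[OF mat_act_abs_pos[OF H nz v Suc.prems]]) auto
  finally show ?case by (simp add: power_mult_distrib mult.assoc mult.left_commute)
qed

section \<open>The equivalence\<close>

theorem theorem3p3: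
  fixes n :: nat and H :: "real mat"
  assumes "n \<ge> 1"
    and "H \<in> carrier_mat n n"
    and "real_spectral_radius H < 1"
    and "no_zero_row H"
    and "no_zero_col H"
  shows "(\<exists>m\<ge>1. \<exists>Ps. transition_hypermatrix n m Ps \<and> admissible H Ps \<and>
            inf_norm_mat (tilde_mat H Ps) < 1)
         \<longleftrightarrow> real_spectral_radius (map_mat abs H) < 1"
proof
  note n = assms(1) and H = assms(2) and nz = assms(4)
  let ?A = "map_mat abs H"
  have A: "?A \<in> carrier_mat n n" and A_nonneg: "\<And>i j. i < n \<Longrightarrow> j < n \<Longrightarrow> 0 \<le> ?A $$ (i, j)"
    using H by auto
  {
    assume "\<exists>m\<ge>1. \<exists>Ps. transition_hypermatrix n m Ps \<and> admissible H Ps \<and>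
            inf_norm_mat (tilde_mat H Ps) < 1"
    then obtain Ps where st: "\<And>P. P \<in> set Ps \<Longrightarrow> row_stochastic n P"
      and adm: "admissible H Ps" and less: "inf_norm_mat (tilde_mat H Ps) < 1"
      by (auto simp: transition_hypermatrix_def)
    have rows: "mat_act (tilde_mat H Ps) (\<lambda>_. 1) i < 1" if "i < n" for i
      using inf_norm_less_iff_mat_act[OF tilde_mat_carrier[OF H] n tilde_mat_nonneg[OF H st]]
        less that by blast
    show "real_spectral_radius ?A < 1"
    proof (rule spectral_radius_less_1_if_power_row_sums_less_1[OF A n A_nonneg])
      fix i assume i: "i < n"
      have "((mat_act ?A ^^ length Ps) (\<lambda>_. 1) i)\<^sup>2 < 1"
        using square_iterates_le_mat_act_tilde[OF H st adm i, of "\<lambda>_. 1"] rows[OF i] by simp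
      then show "(mat_act ?A ^^ length Ps) (\<lambda>_. 1) i < 1"
        by (meson abs_square_less_1 abs_ge_self le_less_trans)
    qed
  next
    assume "real_spectral_radius ?A < 1"
    then obtain v r where r: "0 \<le> r" "r < 1" and v1: "\<And>i. i < n \<Longrightarrow> 1 \<le> v i"
      and contr: "\<And>i. i < n \<Longrightarrow> mat_act ?A v i \<le> r * v i"
      using contracted_positive_vector[OF A n A_nonneg] by metis
    have v: "0 < v i" if "i < n" for i using v1[OF that] by simp
    define P where "P = tilted_transition ?A v"
    have P: "row_stochastic n P"
      unfolding P_def by (rule tilted_transition_row_stochastic[OF H nz v])
    have P_nz: "P $$ (i, j) \<noteq> 0" if "i < n" "j < n" "H $$ (i, j) \<noteq> 0" for i j
    proof -
      have "mat_act ?A v i > 0" by (rule mat_act_abs_pos[OF H nz v that(1)])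
      then show ?thesis using that H v[of j] by (auto simp: P_def tilted_transition_def)
    qed
    have lim: "(\<lambda>m. (r\<^sup>2) ^ m * (v i)\<^sup>2) \<longlonglongrightarrow> 0" for i
      using r by (intro tendsto_mult_left_zero LIMSEQ_power_zero) (simp add: power_less_one_iff)
    have "\<forall>\<^sub>F m in sequentially. m \<ge> 1 \<and> (\<forall>i\<in>{..<n}. (r\<^sup>2) ^ m * (v i)\<^sup>2 < 1)"
      by (intro eventually_conj eventually_ge_at_top eventually_ball_finite ballI
            order_tendstoD(2)[OF lim]) auto
    then obtain m where m: "m \<ge> 1" and small: "\<And>i. i < n \<Longrightarrow> (r\<^sup>2) ^ m * (v i)\<^sup>2 < 1"
      unfolding eventually_sequentially by blast
    define Ps where "Ps = replicate m P"
    have st: "row_stochastic n Q" if "Q \<in> set Ps" for Q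
      using that P by (auto simp: Ps_def)
    have "mat_act (tilde_mat H Ps) (\<lambda>_. 1) i < 1" if i: "i < n" for i
    proof -
      have "mat_act (tilde_mat H Ps) (\<lambda>_. 1) i \<le> mat_act (tilde_mat H Ps) (\<lambda>j. (v j)\<^sup>2) i"
        using v1 by (intro mat_act_mono[OF tilde_mat_carrier[OF H] tilde_mat_nonneg[OF H st]] i)
          (auto simp: one_le_power)
      also have "\<dots> \<le> (r\<^sup>2) ^ m * (v i)\<^sup>2"
        unfolding Ps_def P_def by (rule mat_act_tilde_replicate_tilted_le[OF H nz v contr i])
      finally show ?thesis using small[OF i] by simp
    qed
    then have "inf_norm_mat (tilde_mat H Ps) < 1"
      using inf_norm_less_iff_mat_act[OF tilde_mat_carrier[OF H] n tilde_mat_nonneg[OF H st]]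
      by blast
    moreover have "transition_hypermatrix n m Ps" "admissible H Ps"
      using P P_nz H by (auto simp: transition_hypermatrix_def admissible_def Ps_def)
    ultimately show "\<exists>m\<ge>1. \<exists>Ps. transition_hypermatrix n m Ps \<and> admissible H Ps \<and>
            inf_norm_mat (tilde_mat H Ps) < 1"
      using m by blast
  }
qed

end
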